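(* Consider the following five axioms on a binary operation $\to$ on a bounded lattice $L$, each required for all $a,b,c\in L$: (1) $1\to a\leq a$; (2) $a\wedge b\leq a\to b$; (3) $a\to b\leq a\to(a\wedge b)$; (4) $a\to(b\wedge c)\leq a\to b$; (5) $a\to((a\wedge b)\to c)\leq (a\wedge b)\to c$. These axioms are mutually independent: for each $i\in\{1,2,3,4,5\}$ there exist a bounded lattice $L$ and a binary operation $\to$ on $L$ such that axiom $(i)$ fails while the other four axioms hold.
   Context: A binary operation on a bounded lattice satisfying all five axioms is called a preconditional; $0$ and $1$ denote the bottom and top of the lattice. *)

theory Defs
  imports "HOL-Algebra.Lattice"
begin

text \<open>
  The axioms concern an operation \<open>imp\<close> on the carrier of \<open>L\<close>; values of
  \<open>imp\<close> outside the carrier are irrelevant. Meet and top are those of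
  HOL-Algebra, which are meaningful when \<open>bounded_lattice L\<close> holds.
  HOL has no quantifier over types, so an existential claim over all bounded
  lattices is made over carriers within a fixed type such as \<open>nat\<close>, into which
  every countable lattice embeds.
\<close>

definition binary_operation_on :: "('a, 'm) gorder_scheme \<Rightarrow> ('a \<Rightarrow> 'a \<Rightarrow> 'a) \<Rightarrow> bool" where
  "binary_operation_on L imp \<longleftrightarrow> imp \<in> carrier L \<rightarrow> carrier L \<rightarrow> carrier L"

definition precond_ax1 :: "('a, 'm) gorder_scheme \<Rightarrow> ('a \<Rightarrow> 'a \<Rightarrow> 'a) \<Rightarrow> bool" where
  "precond_ax1 L imp \<longleftrightarrow> (\<forall>a\<in>carrier L. imp \<top>\<^bsub>L\<^esub> a \<sqsubseteq>\<^bsub>L\<^esub> a)"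

definition precond_ax2 :: "('a, 'm) gorder_scheme \<Rightarrow> ('a \<Rightarrow> 'a \<Rightarrow> 'a) \<Rightarrow> bool" where
  "precond_ax2 L imp \<longleftrightarrow>
     (\<forall>a\<in>carrier L. \<forall>b\<in>carrier L. (a \<sqinter>\<^bsub>L\<^esub> b) \<sqsubseteq>\<^bsub>L\<^esub> imp a b)"

definition precond_ax3 :: "('a, 'm) gorder_scheme \<Rightarrow> ('a \<Rightarrow> 'a \<Rightarrow> 'a) \<Rightarrow> bool" where
  "precond_ax3 L imp \<longleftrightarrow>
     (\<forall>a\<in>carrier L. \<forall>b\<in>carrier L. imp a b \<sqsubseteq>\<^bsub>L\<^esub> imp a (a \<sqinter>\<^bsub>L\<^esub> b))"

definition precond_ax4 :: "('a, 'm) gorder_scheme \<Rightarrow> ('a \<Rightarrow> 'a \<Rightarrow> 'a) \<Rightarrow> bool" where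
  "precond_ax4 L imp \<longleftrightarrow>
     (\<forall>a\<in>carrier L. \<forall>b\<in>carrier L. \<forall>c\<in>carrier L.
        imp a (b \<sqinter>\<^bsub>L\<^esub> c) \<sqsubseteq>\<^bsub>L\<^esub> imp a b)"

definition precond_ax5 :: "('a, 'm) gorder_scheme \<Rightarrow> ('a \<Rightarrow> 'a \<Rightarrow> 'a) \<Rightarrow> bool" where
  "precond_ax5 L imp \<longleftrightarrow>
     (\<forall>a\<in>carrier L. \<forall>b\<in>carrier L. \<forall>c\<in>carrier L.
        imp a (imp (a \<sqinter>\<^bsub>L\<^esub> b) c) \<sqsubseteq>\<^bsub>L\<^esub> imp (a \<sqinter>\<^bsub>L\<^esub> b) c)"

definition precond_axiom ::
    "nat \<Rightarrow> ('a, 'm) gorder_scheme \<Rightarrow> ('a \<Rightarrow> 'a \<Rightarrow> 'a) \<Rightarrow> bool" where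
  "precond_axiom i L imp \<longleftrightarrow>
     (i = 1 \<and> precond_ax1 L imp) \<or>
     (i = 2 \<and> precond_ax2 L imp) \<or>
     (i = 3 \<and> precond_ax3 L imp) \<or>
     (i = 4 \<and> precond_ax4 L imp) \<or>
     (i = 5 \<and> precond_ax5 L imp)"

end

theory Submission
  imports Defs
begin

text \<open>The index is the top element, not the size: \<open>chain 1\<close> has two elements and
  \<open>chain 2\<close> has three.\<close>

definition chain :: "nat \<Rightarrow> nat gorder" where
  "chain n = \<lparr>carrier = {..n}, eq = (=), le = (\<le>)\<rparr>"

lemma carrier_chain [simp]: "carrier (chain n) = {..n}"
  and eq_chain [simp]: "x .=\<^bsub>chain n\<^esub> y \<longleftrightarrow> x = y"
  and le_chain [simp]: "x \<sqsubseteq>\<^bsub>chain n\<^esub> y \<longleftrightarrow> x \<le> y"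
  by (simp_all add: chain_def)

lemma partial_order_chain: "partial_order (chain n)"
  by unfold_locales (auto simp: chain_def)

lemma least_chain:
  "x \<le> n \<Longrightarrow> y \<le> n \<Longrightarrow> least (chain n) (max x y) (Upper (chain n) {x, y})"
  by (auto simp: least_def Upper_def)

lemma greatest_chain:
  "x \<le> n \<Longrightarrow> y \<le> n \<Longrightarrow> greatest (chain n) (min x y) (Lower (chain n) {x, y})"
  by (auto simp: greatest_def Lower_def)

lemma bounded_lattice_chain: "bounded_lattice (chain n)"
proof -
  interpret partial_order "chain n" by (rule partial_order_chain)
  show ?thesis
  proof unfold_locales
    show "\<exists>s. least (chain n) s (Upper (chain n) {x, y})"
      if "x \<in> carrier (chain n)" "y \<in> carrier (chain n)" for x y
      using that least_chain by auto
    show "\<exists>s. greatest (chain n) s (Lower (chain n) {x, y})"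
      if "x \<in> carrier (chain n)" "y \<in> carrier (chain n)" for x y
      using that greatest_chain by auto
    show "\<exists>x. least (chain n) x (carrier (chain n))"
      by (rule exI[of _ 0]) (auto simp: least_def)
    show "\<exists>x. greatest (chain n) x (carrier (chain n))"
      by (rule exI[of _ n]) (auto simp: greatest_def)
  qed
qed

text \<open>\<open>meet\<close> is a choice among greatest lower bounds, so its value comes from
  their uniqueness. With it the axioms become inequalities about \<open>min\<close>.\<close>

lemma meet_chain [simp]:
  assumes "x \<le> n" "y \<le> n"
  shows "x \<sqinter>\<^bsub>chain n\<^esub> y = min x y"
proof -
  interpret bounded_lattice "chain n" by (rule bounded_lattice_chain)
  show ?thesis
    using greatest_unique[OF greatest_chain[OF assms]] assms inf_of_two_greatest[of x y]
    by (auto simp: meet_def)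
qed

lemma top_chain [simp]: "\<top>\<^bsub>chain n\<^esub> = n"
proof -
  interpret bounded_lattice "chain n" by (rule bounded_lattice_chain)
  show ?thesis
    using top_closed top_higher[of n] by simp
qed

text \<open>Listing the carrier reduces an axiom to finitely many cases. \<open>Suc 0\<close> is the
  form to which the simplifier brings \<open>1\<close>.\<close>

lemma atMost_Suc_0: "{..Suc 0} = {0, 1}" and atMost_2: "{..2 :: nat} = {0, 1, 2}"
  by auto

lemmas precond_simps = precond_axiom_def binary_operation_on_def
  precond_ax1_def precond_ax2_def precond_ax3_def precond_ax4_def precond_ax5_def

text \<open>On a chain, axioms (3) and (4) together say that \<open>a \<rightarrow> b\<close> is monotone in
  \<open>b\<close> and constant for \<open>b \<ge> a\<close>; on two elements with (1) and (2) this forces (5).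
  Hence the three-element chain for the independence of (5).\<close>

theorem fact1:
  shows "\<forall>i\<in>{1, 2, 3, 4, 5 :: nat}.
    \<exists>(L :: nat gorder) (imp :: nat \<Rightarrow> nat \<Rightarrow> nat).
      bounded_lattice L \<and> binary_operation_on L imp \<and>
      \<not> precond_axiom i L imp \<and>
      (\<forall>j\<in>{1, 2, 3, 4, 5 :: nat} - {i}. precond_axiom j L imp)"
    (is "\<forall>i\<in>_. \<exists>L imp. ?indep i L imp")
proof -
  \<comment> \<open>A constant operation satisfies (3), (4) and (5). With value top it also
    satisfies (2), but (1) fails at a = 0.\<close>
  have "?indep 1 (chain 1) (\<lambda>a b. 1)"
    by (simp add: bounded_lattice_chain precond_simps) auto
  \<comment> \<open>With value bottom, (1) holds and (2) fails at a = b = 1.\<close>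
  moreover have "?indep 2 (chain 1) (\<lambda>a b. 0)"
    by (simp add: bounded_lattice_chain precond_simps) auto
  \<comment> \<open>Here (5) is an equality, while (3) reads b \<le> min a b and fails at a = 0, b =
    1.\<close>
  moreover have "?indep 3 (chain 1) (\<lambda>a b. b)"
    by (simp add: bounded_lattice_chain precond_simps atMost_Suc_0) auto
  \<comment> \<open>On two elements (1), (2) and (5) force (4). Here (4) fails at a = b = 1, c = 0,
    as 2 > 1. For (5) the critical case is a = 1 \<le> b: since 1 \<rightarrow> c is never 0, the
    left side is 1.\<close>
  moreover have "?indep 4 (chain 2) (\<lambda>a b. if a = 2 then b else if a = 1 \<and> b > 0 then 1 else 2)"
    by (simp add: bounded_lattice_chain precond_simps atMost_2) auto
  \<comment> \<open>(1) and (2) force 2 \<rightarrow> b = b. For a < 2 the constant value a lies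
    above every min a b, which gives (2). At a = 1, b = 0, (5) would say 1 \<le> 0.\<close>
  moreover have "?indep 5 (chain 2) (\<lambda>a b. if a = 2 then b else a)"
    by (simp add: bounded_lattice_chain precond_simps atMost_2) auto
  ultimately show ?thesis
    by (metis (no_types, lifting) insertE singletonD)
qed

end
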